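(* Let $\alpha,\beta$ be two given gauge parameters and $1\le m\le N$. For $\boldsymbol\epsilon=(\epsilon_1,\dots,\epsilon_m)$ and $\boldsymbol\epsilon'=(\epsilon'_1,\dots,\epsilon'_m)$ in $\{1,2\}^m$ put $$a_n=\alpha+1,\quad b_n=\beta-\sum_{r=1}^n(-1)^{\epsilon_r},\qquad \bar a_n=\alpha-1,\quad \bar b_n=\beta+\sum_{r=n+1}^m(-1)^{\epsilon'_r}-\sum_{r=1}^m(-1)^{\epsilon_r}\qquad(1\le n\le m).$$ Then the set of monomials of local operators $$\mathbb E_m(\alpha,\beta)=\Big\{\prod_{n=1}^mE_n^{\epsilon'_n,\epsilon_n}(\xi_n|(a_n,b_n),(\bar a_n,\bar b_n))\ \Big|\ \boldsymbol\epsilon,\boldsymbol\epsilon'\in\{1,2\}^m\Big\}$$ is a basis of $\mathrm{End}(\otimes_{n=1}^m\mathcal H_n)$, except for a finite number of values of $\beta$ modulo $i\pi/\eta$.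
   Context: $\eta\in\mathbb C$ with $\sinh\eta\neq0$, $\xi_1,\dots,\xi_N\in\mathbb C$, $\mathcal H_n=\mathbb C^2$. $S(\lambda|\alpha,\beta)=\begin{pmatrix}e^{\lambda-\eta(\beta+\alpha)}&e^{\lambda+\eta(\beta-\alpha)}\\1&1\end{pmatrix}$, and $E_n^{i,j}(\lambda|(\alpha,\beta),(\gamma,\delta))=S_n(-\lambda|\gamma,\delta)\,E_n^{i,j}\,S_n^{-1}(-\lambda|\alpha,\beta)$ is an operator acting on $\mathcal H_n$, where $E^{i,j}$ is the elementary $2\times2$ matrix $(E^{i,j})_{k,\ell}=\delta_{i,k}\delta_{j,\ell}$, $i,j\in\{1,2\}$. *)

theory Defs
  imports "HOL-Analysis.Analysis" "HOL-Library.Function_Algebras"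
begin

text \<open>
  The labels \<open>{1, 2}\<close> are the elements of the type \<open>2\<close>. In this type \<open>2 = 0\<close>, so the sign
  \<open>(-1)^i\<close> cannot be written as a power.
\<close>

definition label_sign :: "2 \<Rightarrow> complex" where
  "label_sign i = (if i = 1 then - 1 else 1)"

definition gauge_S :: "complex \<Rightarrow> complex \<Rightarrow> complex \<Rightarrow> complex \<Rightarrow> complex^2^2" where
  "gauge_S \<eta> l \<alpha> \<beta> = vector
     [vector [exp (l - \<eta> * (\<beta> + \<alpha>)), exp (l + \<eta> * (\<beta> - \<alpha>))],
      vector [1, 1]]"

definition elem_matrix :: "2 \<Rightarrow> 2 \<Rightarrow> complex^2^2" where
  "elem_matrix i j = (\<chi> k l. if i = k \<and> j = l then 1 else 0)"

definition gauge_E ::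
  "complex \<Rightarrow> 2 \<Rightarrow> 2 \<Rightarrow> complex \<Rightarrow> complex \<times> complex \<Rightarrow> complex \<times> complex \<Rightarrow> complex^2^2" where
  "gauge_E \<eta> i j l = (\<lambda>(\<alpha>, \<beta>) (\<gamma>, \<delta>).
     gauge_S \<eta> (- l) \<gamma> \<delta> ** elem_matrix i j ** matrix_inv (gauge_S \<eta> (- l) \<alpha> \<beta>))"

text \<open>
  The tensor product of the spaces \<open>\<H>\<^sub>1, \<dots>, \<H>\<^sub>m\<close>, each equal to \<open>\<complex>\<^sup>2\<close>, has the canonical basis
  \<open>e\<^bsub>\<sigma> 1\<^esub> \<otimes> \<dots> \<otimes> e\<^bsub>\<sigma> m\<^esub>\<close> indexed by the tuples \<open>\<sigma> \<in> {1, 2}\<^sup>m\<close>. A tensor is represented by its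
  coordinate function, which is zero outside the set of these tuples.
\<close>

type_synonym tensor = "(nat \<Rightarrow> 2) \<Rightarrow> complex"

definition tuples :: "nat \<Rightarrow> (nat \<Rightarrow> 2) set" where
  "tuples m = {1..m} \<rightarrow>\<^sub>E UNIV"

definition tensor_space :: "nat \<Rightarrow> tensor set" where
  "tensor_space m = {\<psi>. \<forall>\<sigma>. \<sigma> \<notin> tuples m \<longrightarrow> \<psi> \<sigma> = 0}"

definition tensor_scale :: "complex \<Rightarrow> tensor \<Rightarrow> tensor" where
  "tensor_scale c \<psi> = (\<lambda>\<sigma>. c * \<psi> \<sigma>)"

definition op_scale :: "complex \<Rightarrow> (tensor \<Rightarrow> tensor) \<Rightarrow> (tensor \<Rightarrow> tensor)" where
  "op_scale c A = (\<lambda>\<psi>. tensor_scale c (A \<psi>))"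

global_interpretation tensor: vector_space tensor_scale
  by standard (auto simp: tensor_scale_def fun_eq_iff algebra_simps)

global_interpretation op: vector_space op_scale
  by standard (auto simp: op_scale_def tensor_scale_def fun_eq_iff algebra_simps)

text \<open>
  An endomorphism of \<open>tensor_space m\<close> is represented by its unique linear extension to all
  functions of type \<open>tensor\<close> that vanishes on the complementary subspace of the functions
  that are zero on \<open>tuples m\<close>.
\<close>

definition End_tensor :: "nat \<Rightarrow> (tensor \<Rightarrow> tensor) set" where
  "End_tensor m =
     {A. Vector_Spaces.linear tensor_scale tensor_scale A \<and>
         A ` tensor_space m \<subseteq> tensor_space m \<and>
         (\<forall>\<psi>. (\<forall>\<sigma>\<in>tuples m. \<psi> \<sigma> = 0) \<longrightarrow> A \<psi> = 0)}"

text \<open>The matrix \<open>M\<close> acting on the \<open>n\<close>-th tensor factor, as the identity on the others.\<close>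

definition site_op :: "nat \<Rightarrow> nat \<Rightarrow> complex^2^2 \<Rightarrow> tensor \<Rightarrow> tensor" where
  "site_op m n M \<psi> =
     (\<lambda>\<sigma>. if \<sigma> \<in> tuples m then \<Sum>k\<in>UNIV. M $ \<sigma> n $ k * \<psi> (\<sigma>(n := k)) else 0)"

definition gauge_b :: "complex \<Rightarrow> (nat \<Rightarrow> 2) \<Rightarrow> nat \<Rightarrow> complex" where
  "gauge_b \<beta> \<epsilon> n = \<beta> - (\<Sum>r=1..n. label_sign (\<epsilon> r))"

definition gauge_b_bar ::
  "nat \<Rightarrow> complex \<Rightarrow> (nat \<Rightarrow> 2) \<Rightarrow> (nat \<Rightarrow> 2) \<Rightarrow> nat \<Rightarrow> complex" where
  "gauge_b_bar m \<beta> \<epsilon>' \<epsilon> n =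
     \<beta> + (\<Sum>r=n+1..m. label_sign (\<epsilon>' r)) - (\<Sum>r=1..m. label_sign (\<epsilon> r))"

definition monomial ::
  "complex \<Rightarrow> (nat \<Rightarrow> complex) \<Rightarrow> nat \<Rightarrow> complex \<Rightarrow> complex \<Rightarrow>
   (nat \<Rightarrow> 2) \<Rightarrow> (nat \<Rightarrow> 2) \<Rightarrow> tensor \<Rightarrow> tensor" where
  "monomial \<eta> \<xi> m \<alpha> \<beta> \<epsilon>' \<epsilon> =
     foldr (\<circ>)
       (map (\<lambda>n. site_op m n
               (gauge_E \<eta> (\<epsilon>' n) (\<epsilon> n) (\<xi> n)
                 (\<alpha> + 1, gauge_b \<beta> \<epsilon> n) (\<alpha> - 1, gauge_b_bar m \<beta> \<epsilon>' \<epsilon> n)))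
            [1..<m+1])
       id"

definition monomials ::
  "complex \<Rightarrow> (nat \<Rightarrow> complex) \<Rightarrow> nat \<Rightarrow> complex \<Rightarrow> complex \<Rightarrow> (tensor \<Rightarrow> tensor) set" where
  "monomials \<eta> \<xi> m \<alpha> \<beta> =
     {monomial \<eta> \<xi> m \<alpha> \<beta> \<epsilon>' \<epsilon> | \<epsilon> \<epsilon>'. \<epsilon> \<in> tuples m \<and> \<epsilon>' \<in> tuples m}"

text \<open>
  The function \<open>matrix_inv\<close> is total, so this condition states that all the inverses in
  the definition of the monomials exist.
\<close>

definition monomials_defined ::
  "complex \<Rightarrow> (nat \<Rightarrow> complex) \<Rightarrow> nat \<Rightarrow> complex \<Rightarrow> complex \<Rightarrow> bool" where
  "monomials_defined \<eta> \<xi> m \<alpha> \<beta> \<longleftrightarrow>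
     (\<forall>\<epsilon>\<in>tuples m. \<forall>n\<in>{1..m}. invertible (gauge_S \<eta> (- \<xi> n) (\<alpha> + 1) (gauge_b \<beta> \<epsilon> n)))"

end

theory Submission imports Defs
begin

text \<open>
  Since \<open>S E\<^bsup>i,j\<^esup> T\<^bsup>-1\<^esup>\<close> is the product of column \<open>i\<close> of \<open>S\<close> with row \<open>j\<close> of \<open>T\<^bsup>-1\<^esup>\<close>, every monomial
  is an operator of rank one given by a product vector, depending on \<open>\<epsilon>'\<close> and \<open>\<epsilon>\<close>, and a product
  covector, depending on \<open>\<epsilon>\<close> only. The factor of the covector at site \<open>n\<close> depends on the labels
  \<open>\<epsilon> r\<close> with \<open>r \<le> n\<close>, and that of the vector on \<open>\<epsilon>\<close> and the labels \<open>\<epsilon>' r\<close> with \<open>r \<ge> n\<close>. Because of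
  this triangular dependence, the covectors span the dual space and, for each fixed \<open>\<epsilon>\<close>, the
  vectors span the tensor space, as soon as \<open>sinh (\<eta> (\<beta> + k)) \<noteq> 0\<close> for all integers \<open>k\<close> with
  \<open>\<bar>k\<bar> \<le> 2 m\<close>. Hence the \<open>4\<^sup>m\<close> monomials span a space of dimension \<open>4\<^sup>m\<close>, so they are independent.
\<close>


section \<open>Preliminaries on dimension counting and tuples\<close>

text \<open>A maximal independent subset of \<open>B\<close> still spans \<open>U\<close>, so by the
  exchange bound it has at least \<open>card U\<close> elements and must be all of
  \<open>B\<close>.\<close>

lemma (in vector_space) independent_if_card_le:
  assumes "finite B" "independent U" "U \<subseteq> span B" "card B \<le> card U"
  shows "independent B"
proof -
  obtain C where C: "C \<subseteq> B" "independent C" "B \<subseteq> span C"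
    using maximal_independent_subset by blast
  then have "finite C" using assms(1) finite_subset by blast
  moreover have "U \<subseteq> span C"
    using assms(3) C(3) span_minimal[OF C(3) subspace_span] by blast
  ultimately have "card U \<le> card C"
    using independent_span_bound assms(2) by blast
  then have "C = B" using C(1) assms(1,4) by (simp add: card_seteq)
  with C(2) show ?thesis by simp
qed

lemma sum_fun_eval: "(\<Sum>a\<in>A. f a) x = (\<Sum>a\<in>A. f a x)"
  for f :: "'a \<Rightarrow> 'b \<Rightarrow> 'c::comm_monoid_add"
  by (induction A rule: infinite_finite_induct) auto

lemma finite_tuples [simp]: "finite (tuples m)"
  by (simp add: tuples_def finite_PiE)

lemma tuples_upd: "\<sigma> \<in> tuples m \<Longrightarrow> n \<in> {1..m} \<Longrightarrow> \<sigma>(n := k) \<in> tuples m"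
  by (auto simp: tuples_def PiE_def extensional_def)

lemma tuples_eq_iff:
  "\<sigma> \<in> tuples m \<Longrightarrow> \<tau> \<in> tuples m \<Longrightarrow> \<sigma> = \<tau> \<longleftrightarrow> (\<forall>n\<in>{1..m}. \<sigma> n = \<tau> n)"
  by (metis PiE_ext tuples_def)

lemma prod_of_bool: "finite A \<Longrightarrow> (\<Prod>a\<in>A. of_bool (P a)) = (of_bool (\<forall>a\<in>A. P a) :: 'b::comm_semiring_1)"
  by (induction rule: finite_induct) auto

section \<open>Product tensors\<close>

text \<open>The canonical basis vectors; they also serve as canonical covectors, in the last slot of
  \<open>rank_one\<close>.\<close>

definition unit_tensor :: "(nat \<Rightarrow> 2) \<Rightarrow> tensor" where
  "unit_tensor \<sigma> = (\<lambda>\<tau>. of_bool (\<tau> = \<sigma>))"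

definition product_tensor :: "nat \<Rightarrow> (nat \<Rightarrow> 2 \<Rightarrow> complex) \<Rightarrow> tensor" where
  "product_tensor m u = (\<lambda>\<sigma>. if \<sigma> \<in> tuples m then \<Prod>n\<in>{1..m}. u n (\<sigma> n) else 0)"

lemma product_tensor_in_tensor_space: "product_tensor m u \<in> tensor_space m"
  by (simp add: product_tensor_def tensor_space_def)

lemma product_tensor_unit:
  assumes "\<sigma> \<in> tuples m"
  shows "product_tensor m (\<lambda>n k. of_bool (k = \<sigma> n)) = unit_tensor \<sigma>"
proof
  fix \<tau> show "product_tensor m (\<lambda>n k. of_bool (k = \<sigma> n)) \<tau> = unit_tensor \<sigma> \<tau>"
    using assms
    by (cases "\<tau> \<in> tuples m")
      (auto simp: product_tensor_def unit_tensor_def prod_of_bool tuples_eq_iff[of \<tau> m \<sigma>])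
qed

text \<open>Linearity in the factor \<open>k\<close>. Three families agreeing off \<open>k\<close>
  are used, so that they may come from different label tuples.\<close>

lemma product_tensor_add:
  assumes "k \<in> {1..m}" "\<And>i. w k i = c * u k i + d * v k i"
    and "\<And>n. n \<in> {1..m} - {k} \<Longrightarrow> u n = w n" "\<And>n. n \<in> {1..m} - {k} \<Longrightarrow> v n = w n"
  shows "product_tensor m w =
    tensor_scale c (product_tensor m u) + tensor_scale d (product_tensor m v)"
proof
  fix \<sigma>
  have split: "(\<Prod>n\<in>{1..m}. f n) = f k * (\<Prod>n\<in>{1..m} - {k}. f n)" for f :: "nat \<Rightarrow> complex"
    using assms(1) by (simp add: prod.remove)
  have "(\<Prod>n\<in>{1..m} - {k}. u n (\<sigma> n)) = (\<Prod>n\<in>{1..m} - {k}. w n (\<sigma> n))"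
    "(\<Prod>n\<in>{1..m} - {k}. v n (\<sigma> n)) = (\<Prod>n\<in>{1..m} - {k}. w n (\<sigma> n))"
    using assms(3,4) by (auto intro!: prod.cong)
  then show "product_tensor m w \<sigma> =
    (tensor_scale c (product_tensor m u) + tensor_scale d (product_tensor m v)) \<sigma>"
    by (simp add: product_tensor_def tensor_scale_def split assms(2) ring_distribs del: One_nat_def)
qed

lemma tensor_eq_sum_unit:
  assumes "\<psi> \<in> tensor_space m"
  shows "\<psi> = (\<Sum>\<sigma>\<in>tuples m. tensor_scale (\<psi> \<sigma>) (unit_tensor \<sigma>))"
proof
  fix \<tau>
  have "(\<Sum>\<sigma>\<in>tuples m. tensor_scale (\<psi> \<sigma>) (unit_tensor \<sigma>)) \<tau> =
      (\<Sum>\<sigma>\<in>tuples m. if \<sigma> = \<tau> then \<psi> \<sigma> else 0)"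
    by (auto simp: sum_fun_eval tensor_scale_def unit_tensor_def intro!: sum.cong)
  also have "\<dots> = \<psi> \<tau>"
    using assms by (simp add: sum.delta tensor_space_def)
  finally show "\<psi> \<tau> = (\<Sum>\<sigma>\<in>tuples m. tensor_scale (\<psi> \<sigma>) (unit_tensor \<sigma>)) \<tau>" by simp
qed

text \<open>This allows a unit vector at one site to be expressed through the two vectors given by
  the two values of the label at that site.\<close>

lemma cramer_2:
  fixes f p q :: "2 \<Rightarrow> 'a::field"
  assumes "p 1 * q 2 \<noteq> q 1 * p 2"
  obtains c d where "\<And>i. f i = c * p i + d * q i"
proof -
  define D where "D = p 1 * q 2 - q 1 * p 2"
  define c d where "c = (f 1 * q 2 - q 1 * f 2) / D" and "d = (p 1 * f 2 - f 1 * p 2) / D"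
  have "D \<noteq> 0" using assms by (simp add: D_def)
  have "f i = c * p i + d * q i" if "i = 1 \<or> i = 2" for i
  proof -
    have "D * f i = (f 1 * q 2 - q 1 * f 2) * p i + (p 1 * f 2 - f 1 * p 2) * q i"
      using that by (elim disjE) (simp_all add: D_def algebra_simps)
    then have "f i = ((f 1 * q 2 - q 1 * f 2) * p i + (p 1 * f 2 - f 1 * p 2) * q i) / D"
      using \<open>D \<noteq> 0\<close> by (metis nonzero_mult_div_cancel_left)
    then show ?thesis by (simp add: c_def d_def add_divide_distrib)
  qed
  then show thesis using that exhaust_2 by blast
qed

text \<open>
  The vector at site \<open>n\<close> may depend on the labels of the sites preceding \<open>n\<close> in the order given by
  \<open>r\<close>. The unit vectors are then obtained by replacing the product vectors site by site, starting
  with the last one.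
\<close>

lemma tensor_space_subset_span_product_tensor:
  fixes u :: "(nat \<Rightarrow> 2) \<Rightarrow> nat \<Rightarrow> 2 \<Rightarrow> complex" and r :: "nat \<Rightarrow> int"
  assumes dep: "\<And>n k \<epsilon> j. r n \<le> r k \<Longrightarrow> n \<noteq> k \<Longrightarrow> n \<in> {1..m} \<Longrightarrow> k \<in> {1..m} \<Longrightarrow>
      u (\<epsilon>(k := j)) n = u \<epsilon> n"
    and det: "\<And>k \<epsilon>. k \<in> {1..m} \<Longrightarrow>
      u (\<epsilon>(k := 1)) k 1 * u (\<epsilon>(k := 2)) k 2 \<noteq> u (\<epsilon>(k := 2)) k 1 * u (\<epsilon>(k := 1)) k 2"
  shows "tensor_space m \<subseteq> tensor.span ((\<lambda>\<epsilon>. product_tensor m (u \<epsilon>)) ` tuples m)"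
    (is "_ \<subseteq> ?T")
proof -
  have unit: "unit_tensor \<sigma> \<in> ?T" if \<sigma>: "\<sigma> \<in> tuples m" for \<sigma>
  proof -
    \<comment> \<open>Sites in \<open>S\<close> carry the given vectors, the others the unit vectors
      of \<open>\<sigma>\<close>; \<open>S\<close> interpolates between
      \<open>unit_tensor \<sigma>\<close> (empty) and \<open>product_tensor m (u \<epsilon>)\<close>
      (all sites).\<close>
    define mix where
      "mix S \<epsilon> = product_tensor m (\<lambda>n. if n \<in> S then u \<epsilon> n else (\<lambda>k. of_bool (k = \<sigma> n)))"
      for S \<epsilon>
    have "S \<subseteq> {1..m} \<longrightarrow> (\<forall>\<epsilon>\<in>tuples m. mix S \<epsilon> \<in> ?T) \<longrightarrow> unit_tensor \<sigma> \<in> ?T"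
      if "finite S" for S
      using that
    proof (induction S rule: finite_ranking_induct[where f = r])
      case empty
      then show ?case using \<sigma> by (auto simp: mix_def product_tensor_unit)
    next
      case (insert k S)
      show ?case
      proof (intro impI)
        assume sub: "insert k S \<subseteq> {1..m}"
          and mixed: "\<forall>\<epsilon>\<in>tuples m. mix (insert k S) \<epsilon> \<in> ?T"
        have "mix S \<epsilon> \<in> ?T" if \<epsilon>: "\<epsilon> \<in> tuples m" for \<epsilon>
        \<comment> \<open>The ranking induction supplies a \<open>k\<close> of maximal rank, but
          does not exclude that it already lies in \<open>S\<close>.\<close>
        proof (cases "k \<in> S")
          case True
          then show ?thesis using mixed \<epsilon> by (simp add: insert_absorb)
        next
          case False
          have k: "k \<in> {1..m}" using sub by simp
          obtain c d where cd:
            "\<And>i. of_bool (i = \<sigma> k) = c * u (\<epsilon>(k := 1)) k i + d * u (\<epsilon>(k := 2)) k i"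
            using cramer_2[OF det[OF k, of \<epsilon>], of "\<lambda>i. of_bool (i = \<sigma> k)"] by blast
          \<comment> \<open>Every site of \<open>S\<close> has rank at most that of
            \<open>k\<close>, so its vector ignores the label at \<open>k\<close>; changing that
            label alters only the factor \<open>k\<close>.\<close>
          have same: "u (\<epsilon>(k := j)) n = u \<epsilon> n" if "n \<in> S" for n j
            by (rule dep) (use that insert.hyps sub False in auto)
          have "mix S \<epsilon> = tensor_scale c (mix (insert k S) (\<epsilon>(k := 1))) +
              tensor_scale d (mix (insert k S) (\<epsilon>(k := 2)))"
            unfolding mix_def
            by (rule product_tensor_add[OF k]) (use False same in \<open>auto simp: cd[symmetric]\<close>)
          then show ?thesis
            using mixed tuples_upd[OF \<epsilon> k]
            by (simp add: tensor.span_add tensor.span_scale)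
        qed
        then show "unit_tensor \<sigma> \<in> ?T" using insert.IH sub by blast
      qed
    qed
    from this[of "{1..m}"] have
      "\<forall>\<epsilon>\<in>tuples m. mix {1..m} \<epsilon> \<in> ?T \<Longrightarrow> unit_tensor \<sigma> \<in> ?T" by simp
    moreover have "mix {1..m} \<epsilon> = product_tensor m (u \<epsilon>)" for \<epsilon>
      by (auto simp: mix_def product_tensor_def fun_eq_iff intro!: prod.cong)
    ultimately show ?thesis by (simp add: tensor.span_base)
  qed
  show ?thesis
  proof
    fix \<psi> assume "\<psi> \<in> tensor_space m"
    then show "\<psi> \<in> ?T"
      by (subst tensor_eq_sum_unit) (auto intro!: tensor.span_sum tensor.span_scale unit)
  qed
qed

section \<open>Operators of rank one\<close>

text \<open>The pairing with the covector \<open>\<phi>\<close> is bilinear, without conjugation, so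
  the operator is linear in both \<open>\<psi>\<close> and \<open>\<phi>\<close>.\<close>

definition rank_one :: "nat \<Rightarrow> tensor \<Rightarrow> tensor \<Rightarrow> tensor \<Rightarrow> tensor" where
  "rank_one m \<psi> \<phi> = (\<lambda>\<omega>. tensor_scale (\<Sum>\<sigma>\<in>tuples m. \<phi> \<sigma> * \<omega> \<sigma>) \<psi>)"

lemma rank_one_left:
  "rank_one m (\<psi> + \<psi>') \<phi> = rank_one m \<psi> \<phi> + rank_one m \<psi>' \<phi>"
  "rank_one m (tensor_scale c \<psi>) \<phi> = op_scale c (rank_one m \<psi> \<phi>)"
  "rank_one m 0 \<phi> = 0"
  by (auto simp: rank_one_def op_scale_def tensor_scale_def fun_eq_iff algebra_simps)

lemma rank_one_right:
  "rank_one m \<psi> (\<phi> + \<phi>') = rank_one m \<psi> \<phi> + rank_one m \<psi> \<phi>'"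
  "rank_one m \<psi> (tensor_scale c \<phi>) = op_scale c (rank_one m \<psi> \<phi>)"
  "rank_one m \<psi> 0 = 0"
  by (auto simp: rank_one_def op_scale_def tensor_scale_def fun_eq_iff algebra_simps
      sum.distrib sum_distrib_left sum_distrib_right)

lemma rank_one_unit:
  "\<sigma> \<in> tuples m \<Longrightarrow> rank_one m \<psi> (unit_tensor \<sigma>) \<omega> = tensor_scale (\<omega> \<sigma>) \<psi>"
  by (simp add: rank_one_def unit_tensor_def of_bool_def if_distrib[of "\<lambda>x. x * _"] cong: if_cong)

lemma rank_one_in_End:
  assumes "\<psi> \<in> tensor_space m"
  shows "rank_one m \<psi> \<phi> \<in> End_tensor m"
proof -
  have "Vector_Spaces.linear tensor_scale tensor_scale (rank_one m \<psi> \<phi>)"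
    by unfold_locales
      (auto simp: rank_one_def tensor_scale_def fun_eq_iff algebra_simps sum.distrib
        sum_distrib_left sum_distrib_right)
  moreover have "rank_one m \<psi> \<phi> ` tensor_space m \<subseteq> tensor_space m"
    using assms by (auto simp: rank_one_def tensor_scale_def tensor_space_def)
  moreover have "rank_one m \<psi> \<phi> \<omega> = 0" if "\<forall>\<sigma>\<in>tuples m. \<omega> \<sigma> = 0" for \<omega> :: tensor
    using that by (auto simp: rank_one_def tensor_scale_def fun_eq_iff)
  ultimately show ?thesis by (auto simp: End_tensor_def)
qed

lemma End_eq_sum_rank_one:
  assumes "A \<in> End_tensor m"
  shows "A = (\<Sum>\<sigma>\<in>tuples m. rank_one m (A (unit_tensor \<sigma>)) (unit_tensor \<sigma>))"
proof
  fix \<omega> :: tensor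
  interpret A: Vector_Spaces.linear tensor_scale tensor_scale A
    using assms by (simp add: End_tensor_def)
  \<comment> \<open>Truncation to \<open>tuples m\<close> changes \<open>\<omega>\<close> only by a
    function that vanishes on the tuples, which \<open>A\<close> annihilates by the convention in
    \<open>End_tensor\<close>.\<close>
  define \<omega>' where "\<omega>' = (\<lambda>\<sigma>. if \<sigma> \<in> tuples m then \<omega> \<sigma> else 0)"
  have "A (\<omega> - \<omega>') = 0"
    using assms by (auto simp: End_tensor_def \<omega>'_def)
  then have "A \<omega> = A \<omega>'" by (simp add: A.diff)
  also have "\<omega>' = (\<Sum>\<sigma>\<in>tuples m. tensor_scale (\<omega>' \<sigma>) (unit_tensor \<sigma>))"
    by (rule tensor_eq_sum_unit) (simp add: \<omega>'_def tensor_space_def)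
  also have "A \<dots> = (\<Sum>\<sigma>\<in>tuples m. tensor_scale (\<omega> \<sigma>) (A (unit_tensor \<sigma>)))"
    by (simp add: A.sum A.scale \<omega>'_def)
  also have "\<dots> = (\<Sum>\<sigma>\<in>tuples m. rank_one m (A (unit_tensor \<sigma>)) (unit_tensor \<sigma>)) \<omega>"
    by (simp add: sum_fun_eval rank_one_unit)
  finally show "A \<omega> = (\<Sum>\<sigma>\<in>tuples m. rank_one m (A (unit_tensor \<sigma>)) (unit_tensor \<sigma>)) \<omega>" .
qed

lemma unit_tensor_in_tensor_space: "\<sigma> \<in> tuples m \<Longrightarrow> unit_tensor \<sigma> \<in> tensor_space m"
  by (auto simp: unit_tensor_def tensor_space_def)

lemma subspace_End: "op.subspace (End_tensor m)"
proof -
  have lin: "Vector_Spaces.linear tensor_scale tensor_scale A \<longleftrightarrow>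
     (\<forall>x y. A (x + y) = A x + A y) \<and> (\<forall>c x. A (tensor_scale c x) = tensor_scale c (A x))" for A
    by (simp add: Vector_Spaces.linear_iff tensor.vector_space_axioms)
  show ?thesis
    by (auto simp: op.subspace_def End_tensor_def lin tensor_space_def op_scale_def
        tensor_scale_def fun_eq_iff algebra_simps image_subset_iff)
qed

text \<open>These are the matrix units: applying one to \<open>unit_tensor \<tau>\<close> and
  reading the coordinate \<open>\<sigma>\<close> recovers both labels. Injectivity yields the exact
  count of \<open>4^m\<close>.\<close>

lemma inj_rank_one_unit:
  "inj_on (\<lambda>(\<sigma>, \<tau>). rank_one m (unit_tensor \<sigma>) (unit_tensor \<tau>)) (tuples m \<times> tuples m)"
proof (rule inj_onI, clarify)
  fix \<sigma> \<tau> \<sigma>' \<tau>'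
  assume t: "\<sigma> \<in> tuples m" "\<tau> \<in> tuples m" "\<sigma>' \<in> tuples m" "\<tau>' \<in> tuples m"
    and eq: "rank_one m (unit_tensor \<sigma>) (unit_tensor \<tau>) =
      rank_one m (unit_tensor \<sigma>') (unit_tensor \<tau>')"
  then have "tensor_scale (unit_tensor \<tau> \<tau>) (unit_tensor \<sigma>) =
      tensor_scale (unit_tensor \<tau> \<tau>') (unit_tensor \<sigma>')"
    by (metis rank_one_unit)
  then have "1 = unit_tensor \<tau> \<tau>' * unit_tensor \<sigma>' \<sigma>"
    unfolding tensor_scale_def by (metis (mono_tags) mult_1 of_bool_eq(2) unit_tensor_def)
  then show "\<sigma> = \<sigma>' \<and> \<tau> = \<tau>'"
    by (auto simp: unit_tensor_def of_bool_def split: if_splits)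
qed

lemma independent_rank_one_unit:
  "op.independent ((\<lambda>(\<sigma>, \<tau>). rank_one m (unit_tensor \<sigma>) (unit_tensor \<tau>)) `
     (tuples m \<times> tuples m))"
  (is "op.independent (?R ` ?I)")
proof -
  have "c (?R (\<sigma>, \<tau>)) = 0"
    if zero: "(\<Sum>A\<in>?R ` ?I. op_scale (c A) A) = 0" and t: "\<sigma> \<in> tuples m" "\<tau> \<in> tuples m"
    for c \<sigma> \<tau>
  proof -
    have "0 = (\<Sum>A\<in>?R ` ?I. op_scale (c A) A) (unit_tensor \<tau>) \<sigma>"
      using zero by simp
    also have "\<dots> = (\<Sum>x\<in>?I. op_scale (c (?R x)) (?R x) (unit_tensor \<tau>) \<sigma>)"
      by (simp add: sum.reindex[OF inj_rank_one_unit] sum_fun_eval)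
    also have "\<dots> = (\<Sum>x\<in>?I. if x = (\<sigma>, \<tau>) then c (?R x) else 0)"
    proof (rule sum.cong[OF refl],
        simp only: split_paired_all mem_Times_iff fst_conv snd_conv prod.case)
      fix \<sigma>' \<tau>' assume "\<sigma>' \<in> tuples m \<and> \<tau>' \<in> tuples m"
      then show "op_scale (c (rank_one m (unit_tensor \<sigma>') (unit_tensor \<tau>')))
          (rank_one m (unit_tensor \<sigma>') (unit_tensor \<tau>')) (unit_tensor \<tau>) \<sigma> =
        (if (\<sigma>', \<tau>') = (\<sigma>, \<tau>) then c (rank_one m (unit_tensor \<sigma>') (unit_tensor \<tau>')) else 0)"
        by (auto simp: op_scale_def rank_one_unit tensor_scale_def)
          (auto simp: unit_tensor_def)
    qed
    also have "\<dots> = c (?R (\<sigma>, \<tau>))"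
      using t by (subst sum.delta) auto
    finally show ?thesis by simp
  qed
  then show ?thesis
    by (subst op.dependent_finite) auto
qed

section \<open>The monomials\<close>

text \<open>The matrix entries of a partial product: sites not yet in the list contribute the
  identity kernel. Membership of \<open>\<sigma>\<close> in \<open>tuples m\<close> matters for the
  empty list, where \<open>id\<close> does not truncate.\<close>

lemma foldr_site_op:
  assumes "distinct ns" "set ns \<subseteq> {1..m}" "\<sigma> \<in> tuples m"
  shows "foldr (\<circ>) (map (\<lambda>n. site_op m n (M n)) ns) id \<psi> \<sigma> =
    (\<Sum>\<tau>\<in>tuples m. (\<Prod>l\<in>{1..m}. if l \<in> set ns then M l $ \<sigma> l $ \<tau> l
      else of_bool (\<sigma> l = \<tau> l)) * \<psi> \<tau>)"
  using assms
proof (induction ns arbitrary: \<sigma>)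
  case Nil
  have "(\<Sum>\<tau>\<in>tuples m. (\<Prod>l\<in>{1..m}. of_bool (\<sigma> l = \<tau> l)) * \<psi> \<tau>) =
      (\<Sum>\<tau>\<in>tuples m. if \<tau> = \<sigma> then \<psi> \<tau> else 0)"
    using Nil by (intro sum.cong) (auto simp: prod_of_bool tuples_eq_iff[of _ m \<sigma>] Bex_def)
  then show ?case using Nil by simp
next
  case (Cons n ns)
  define G where "G \<sigma> \<tau> l = (if l \<in> set ns then M l $ \<sigma> l $ \<tau> l else of_bool (\<sigma> l = \<tau> l))"
    for \<sigma> \<tau> l
  have n: "n \<in> {1..m}" "n \<notin> set ns" using Cons.prems by auto
  have "foldr (\<circ>) (map (\<lambda>n. site_op m n (M n)) (n # ns)) id \<psi> \<sigma> =
      (\<Sum>k\<in>UNIV. M n $ \<sigma> n $ k *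
        (\<Sum>\<tau>\<in>tuples m. (\<Prod>l\<in>{1..m}. G (\<sigma>(n := k)) \<tau> l) * \<psi> \<tau>))"
  proof -
    have "foldr (\<circ>) (map (\<lambda>n. site_op m n (M n)) (n # ns)) id \<psi> \<sigma> =
        (\<Sum>k\<in>UNIV. M n $ \<sigma> n $ k *
          foldr (\<circ>) (map (\<lambda>n. site_op m n (M n)) ns) id \<psi> (\<sigma>(n := k)))"
      using Cons.prems(3) by (simp only: list.map foldr.simps comp_apply site_op_def if_True)
    then show ?thesis
      using Cons.prems Cons.IH[OF _ _ tuples_upd[OF Cons.prems(3) n(1)]]
      by (simp only: G_def distinct.simps list.set insert_subset simp_thms)
  qed
  also have "\<dots> = (\<Sum>\<tau>\<in>tuples m. (\<Sum>k\<in>UNIV. M n $ \<sigma> n $ k *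
      (\<Prod>l\<in>{1..m}. G (\<sigma>(n := k)) \<tau> l)) * \<psi> \<tau>)"
    by (simp add: sum_distrib_left sum_distrib_right mult.assoc) (rule sum.swap)
  \<comment> \<open>As \<open>n\<close> is not in \<open>ns\<close>, the inner product has a
    Kronecker delta at site \<open>n\<close>, which collapses the sum to
    \<open>k = \<tau> n\<close>.\<close>
  also have "\<dots> = (\<Sum>\<tau>\<in>tuples m. (M n $ \<sigma> n $ \<tau> n * (\<Prod>l\<in>{1..m} - {n}. G \<sigma> \<tau> l)) * \<psi> \<tau>)"
  proof (rule sum.cong[OF refl])
    fix \<tau>
    have "(\<Prod>l\<in>{1..m}. G (\<sigma>(n := k)) \<tau> l) =
        of_bool (k = \<tau> n) * (\<Prod>l\<in>{1..m} - {n}. G \<sigma> \<tau> l)" for k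
    proof -
      have "(\<Prod>l\<in>{1..m} - {n}. G (\<sigma>(n := k)) \<tau> l) = (\<Prod>l\<in>{1..m} - {n}. G \<sigma> \<tau> l)"
        by (rule prod.cong) (auto simp: G_def)
      then show ?thesis using n by (simp add: prod.remove[of _ n] G_def)
    qed
    then have "(\<Sum>k\<in>UNIV. M n $ \<sigma> n $ k * (\<Prod>l\<in>{1..m}. G (\<sigma>(n := k)) \<tau> l)) =
        (\<Sum>k\<in>UNIV. if k = \<tau> n then M n $ \<sigma> n $ k * (\<Prod>l\<in>{1..m} - {n}. G \<sigma> \<tau> l) else 0)"
      by (intro sum.cong) auto
    then show "(\<Sum>k\<in>UNIV. M n $ \<sigma> n $ k * (\<Prod>l\<in>{1..m}. G (\<sigma>(n := k)) \<tau> l)) * \<psi> \<tau> =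
        (M n $ \<sigma> n $ \<tau> n * (\<Prod>l\<in>{1..m} - {n}. G \<sigma> \<tau> l)) * \<psi> \<tau>"
      by simp
  qed
  also have "\<dots> = (\<Sum>\<tau>\<in>tuples m. (\<Prod>l\<in>{1..m}. if l \<in> set (n # ns) then M l $ \<sigma> l $ \<tau> l
      else of_bool (\<sigma> l = \<tau> l)) * \<psi> \<tau>)"
    using n by (auto simp: prod.remove[of _ n] G_def intro!: sum.cong prod.cong)
  finally show ?case .
qed

text \<open>A tensor product of rank one matrices has rank one. For \<open>m = 0\<close> the left
  side would be \<open>id\<close>, which does not vanish off the tuples.\<close>

lemma foldr_site_op_rank_one:
  assumes "1 \<le> m" "\<And>n k l. n \<in> {1..m} \<Longrightarrow> M n $ k $ l = p n k * q n l"
  shows "foldr (\<circ>) (map (\<lambda>n. site_op m n (M n)) [1..<m+1]) id =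
    rank_one m (product_tensor m p) (product_tensor m q)"
proof (intro ext)
  fix \<psi> \<sigma>
  let ?F = "foldr (\<circ>) (map (\<lambda>n. site_op m n (M n)) [1..<m+1]) id"
  show "?F \<psi> \<sigma> = rank_one m (product_tensor m p) (product_tensor m q) \<psi> \<sigma>"
  proof (cases "\<sigma> \<in> tuples m")
    case True
    have "?F \<psi> \<sigma> = (\<Sum>\<tau>\<in>tuples m. (\<Prod>l\<in>{1..m}. p l (\<sigma> l) * q l (\<tau> l)) * \<psi> \<tau>)"
      by (subst foldr_site_op) (auto simp: True assms(2) intro!: sum.cong prod.cong)
    then show ?thesis
      using True
      by (auto simp: rank_one_def tensor_scale_def product_tensor_def prod.distrib
          sum_distrib_left sum_distrib_right intro!: sum.cong)
  next
    case False
    \<comment> \<open>This exposes the outermost factor, whose output is zero outside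
      \<open>tuples m\<close>.\<close>
    have "[1..<m+1] = 1 # [2..<m+1]" using assms(1) by (simp add: upt_rec numeral_2_eq_2)
    then have "?F \<psi> \<sigma> = 0" using False by (simp only:) (simp add: site_op_def)
    then show ?thesis
      using False by (simp add: rank_one_def tensor_scale_def product_tensor_def)
  qed
qed

section \<open>Gauge matrices and the rows of their inverses\<close>

lemma gauge_E_nth:
  "gauge_E \<eta> i j l (\<alpha>, \<beta>) (\<gamma>, \<delta>) $ k $ h =
    gauge_S \<eta> (- l) \<gamma> \<delta> $ k $ i * matrix_inv (gauge_S \<eta> (- l) \<alpha> \<beta>) $ j $ h"
proof -
  show ?thesis
    using exhaust_2[of i] exhaust_2[of j]
    by (auto simp: gauge_E_def elem_matrix_def matrix_matrix_mult_def sum_2)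
qed

lemma gauge_S_nth:
  "gauge_S \<eta> l \<alpha> \<beta> $ 1 $ 1 = exp (l - \<eta> * (\<beta> + \<alpha>))"
  "gauge_S \<eta> l \<alpha> \<beta> $ 1 $ 2 = exp (l + \<eta> * (\<beta> - \<alpha>))"
  "gauge_S \<eta> l \<alpha> \<beta> $ 2 $ 1 = 1"
  "gauge_S \<eta> l \<alpha> \<beta> $ 2 $ 2 = 1"
  by (simp_all add: gauge_S_def vector_2)

text \<open>\<open>\<alpha>\<close> and \<open>l\<close> enter only through a nonzero factor, so
  invertibility is the condition \<open>sinh (\<eta> * \<beta>) \<noteq> 0\<close>.\<close>

lemma det_gauge_S:
  "det (gauge_S \<eta> l \<alpha> \<beta>) = - 2 * exp (l - \<eta> * \<alpha>) * sinh (\<eta> * \<beta>)"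
  by (simp add: det_2 gauge_S_nth sinh_field_def exp_add exp_diff exp_minus field_simps)

lemma matrix_inv_gauge_S:
  fixes \<eta> \<alpha> \<beta> l :: complex
  assumes "sinh (\<eta> * \<beta>) \<noteq> 0"
  defines "S \<equiv> gauge_S \<eta> l \<alpha> \<beta>"
  shows "matrix_inv S $ 1 $ 1 = 1 / det S"
    "matrix_inv S $ 1 $ 2 = - exp (l + \<eta> * (\<beta> - \<alpha>)) / det S"
    "matrix_inv S $ 2 $ 1 = - 1 / det S"
    "matrix_inv S $ 2 $ 2 = exp (l - \<eta> * (\<beta> + \<alpha>)) / det S"
proof -
  have D: "det S \<noteq> 0" using assms by (simp add: det_gauge_S)
  then have inv: "matrix_inv S ** S = mat 1"
    unfolding invertible_det_nz[symmetric] invertible_def matrix_inv_def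
    by (metis (mono_tags, lifting) someI_ex)
  have "(matrix_inv S ** S) $ i $ j = mat 1 $ i $ j" for i j
    using inv by simp
  from this[of 1 1] this[of 1 2] this[of 2 1] this[of 2 2]
  have eqs: "matrix_inv S $ 1 $ 1 * S $ 1 $ 1 + matrix_inv S $ 1 $ 2 = 1"
    "matrix_inv S $ 1 $ 1 * S $ 1 $ 2 + matrix_inv S $ 1 $ 2 = 0"
    "matrix_inv S $ 2 $ 1 * S $ 1 $ 1 + matrix_inv S $ 2 $ 2 = 0"
    "matrix_inv S $ 2 $ 1 * S $ 1 $ 2 + matrix_inv S $ 2 $ 2 = 1"
    by (simp_all add: matrix_matrix_mult_def sum_2 mat_def S_def gauge_S_nth)
  have det: "det S = S $ 1 $ 1 - S $ 1 $ 2" by (simp add: det_2 S_def gauge_S_nth)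
  have S: "S $ 1 $ 1 = exp (l - \<eta> * (\<beta> + \<alpha>))" "S $ 1 $ 2 = exp (l + \<eta> * (\<beta> - \<alpha>))"
    by (simp_all add: S_def gauge_S_nth)
  \<comment> \<open>The second row of \<open>S\<close> is \<open>(1, 1)\<close>, so subtracting the
    two equations for each row of the inverse leaves a multiple of \<open>det S\<close>.\<close>
  have a: "matrix_inv S $ 1 $ 1 * det S = 1" "matrix_inv S $ 2 $ 1 * det S = - 1"
    using eqs unfolding det by algebra+
  moreover have "matrix_inv S $ 1 $ 2 * det S = - S $ 1 $ 2"
    "matrix_inv S $ 2 $ 2 * det S = S $ 1 $ 1"
    using a eqs by algebra+
  ultimately show "matrix_inv S $ 1 $ 1 = 1 / det S"
    "matrix_inv S $ 1 $ 2 = - exp (l + \<eta> * (\<beta> - \<alpha>)) / det S"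
    "matrix_inv S $ 2 $ 1 = - 1 / det S"
    "matrix_inv S $ 2 $ 2 = exp (l - \<eta> * (\<beta> + \<alpha>)) / det S"
    unfolding S[symmetric] using D by (simp_all only: nonzero_eq_divide_eq not_False_eq_True)
qed

text \<open>
  The second row of the inverse at \<open>b - 1\<close> and the first row at \<open>b + 1\<close> annihilate the columns
  with exponents \<open>1 - b\<close> and \<open>1 + b\<close>. This shift is the reason for the choice of \<open>gauge_b\<close>.
\<close>

lemma rows_matrix_inv_gauge_S_independent:
  fixes \<eta> \<alpha> b l :: complex
  assumes "sinh (\<eta> * b) \<noteq> 0" "sinh (\<eta> * (b + 1)) \<noteq> 0" "sinh (\<eta> * (b - 1)) \<noteq> 0"
  defines "P \<equiv> matrix_inv (gauge_S \<eta> l \<alpha> (b + 1))" and "Q \<equiv> matrix_inv (gauge_S \<eta> l \<alpha> (b - 1))"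
  shows "P $ 1 $ 1 * Q $ 2 $ 2 \<noteq> Q $ 2 $ 1 * P $ 1 $ 2"
proof -
  let ?d = "det (gauge_S \<eta> l \<alpha> (b + 1))" and ?e = "det (gauge_S \<eta> l \<alpha> (b - 1))"
  have nz: "?d \<noteq> 0" "?e \<noteq> 0" using assms by (simp_all add: det_gauge_S)
  have "P $ 1 $ 1 * Q $ 2 $ 2 - Q $ 2 $ 1 * P $ 1 $ 2 =
      (exp (l - \<eta> * (b - 1 + \<alpha>)) - exp (l + \<eta> * (b + 1 - \<alpha>))) / (?d * ?e)"
    unfolding P_def Q_def matrix_inv_gauge_S[OF assms(2)] matrix_inv_gauge_S[OF assms(3)]
    using nz by (simp add: field_simps)
  \<comment> \<open>Both exponents contain \<open>l + \<eta> * (1 - \<alpha>)\<close>; what remains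
    is minus and plus \<open>\<eta> * b\<close>, whence the \<open>sinh\<close>.\<close>
  also have "exp (l - \<eta> * (b - 1 + \<alpha>)) - exp (l + \<eta> * (b + 1 - \<alpha>)) =
      - 2 * exp (l + \<eta> * (1 - \<alpha>)) * sinh (\<eta> * b)"
    by (simp add: sinh_field_def exp_add exp_diff exp_minus field_simps)
  finally show ?thesis using nz assms(1) by auto
qed

section \<open>The exceptional values of the gauge parameter\<close>

text \<open>Bounds how far the gauge parameters move from \<open>\<beta>\<close>, and always by an
  integer; hence finitely many exceptional values suffice.\<close>

lemma sum_label_sign:
  "\<exists>k::int. \<bar>k\<bar> \<le> int (card A) \<and> (\<Sum>r\<in>A. label_sign (\<epsilon> r)) = of_int k"
proof (induction A rule: infinite_finite_induct)
  case (insert x A)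
  then obtain k :: int where "\<bar>k\<bar> \<le> int (card A)" "(\<Sum>r\<in>A. label_sign (\<epsilon> r)) = of_int k" by blast
  with insert.hyps show ?case
    by (intro exI[of _ "k + (if \<epsilon> x = 1 then - 1 else 1)"]) (auto simp: label_sign_def)
qed auto

lemma sinh_eq_0_complex:
  assumes "sinh (\<eta> * z) = 0" "\<eta> \<noteq> (0::complex)"
  obtains k :: int where "z = of_int k * (\<i> * of_real pi / \<eta>)"
proof -
  have "exp (\<eta> * z) = exp (- (\<eta> * z))"
    using assms(1) by (simp add: sinh_field_def)
  then obtain k :: int where "\<eta> * z = - (\<eta> * z) + (of_int (2 * k) * pi) * \<i>"
    unfolding exp_eq by blast
  then have "2 * (\<eta> * z) = 2 * (of_int k * pi * \<i>)" by simp
  then have "\<eta> * z = of_int k * pi * \<i>" by (simp only: mult_cancel_left) simp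
  then have "z = of_int k * (\<i> * of_real pi / \<eta>)" using assms(2) by (simp add: field_simps)
  then show thesis by (rule that)
qed

theorem proposition4p3:
  fixes \<eta> \<alpha> :: complex and \<xi> :: "nat \<Rightarrow> complex" and N m :: nat
  assumes "sinh \<eta> \<noteq> 0" and "1 \<le> m" and "m \<le> N"
  shows "\<exists>F :: complex set. finite F \<and>
    (\<forall>\<beta>. (\<forall>f\<in>F. \<forall>k::int. \<beta> \<noteq> f + of_int k * (\<i> * of_real pi / \<eta>)) \<longrightarrow>
       monomials_defined \<eta> \<xi> m \<alpha> \<beta> \<and>
       op.independent (monomials \<eta> \<xi> m \<alpha> \<beta>) \<and>
       op.span (monomials \<eta> \<xi> m \<alpha> \<beta>) = End_tensor m)"
proof -
  \<comment> \<open>\<open>gauge_b\<close> differs from \<open>\<beta>\<close> by at most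
    \<open>m\<close> signs, and \<open>gauge_b_bar\<close> by at most \<open>2 * m\<close>.\<close>
  define F where "F = (of_int ` {- int (2 * m)..int (2 * m)} :: complex set)"
  have "\<eta> \<noteq> 0" using assms(1) by auto
  have main: "monomials_defined \<eta> \<xi> m \<alpha> \<beta> \<and> op.independent (monomials \<eta> \<xi> m \<alpha> \<beta>) \<and>
       op.span (monomials \<eta> \<xi> m \<alpha> \<beta>) = End_tensor m"
    if \<beta>: "\<forall>f\<in>F. \<forall>k::int. \<beta> \<noteq> f + of_int k * (\<i> * of_real pi / \<eta>)" for \<beta>
  proof -
    have nz: "sinh (\<eta> * (\<beta> + of_int k)) \<noteq> 0" if "\<bar>k\<bar> \<le> int (2 * m)" for k
    proof
      assume "sinh (\<eta> * (\<beta> + of_int k)) = 0"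
      then obtain h :: int where h: "\<beta> + of_int k = of_int h * (\<i> * of_real pi / \<eta>)"
        using sinh_eq_0_complex \<open>\<eta> \<noteq> 0\<close> by blast
      have "of_int (- k) \<in> F" unfolding F_def by (rule imageI) (use that in auto)
      moreover have "\<beta> = of_int (- k) + of_int h * (\<i> * of_real pi / \<eta>)"
        using h by (simp add: algebra_simps)
      ultimately show False using \<beta> by blast
    qed
    have nz_b: "sinh (\<eta> * gauge_b \<beta> \<epsilon> n) \<noteq> 0" if "n \<le> m" for \<epsilon> n
    proof -
      obtain k :: int where k: "\<bar>k\<bar> \<le> int n" "(\<Sum>r=1..n. label_sign (\<epsilon> r)) = of_int k"
        using sum_label_sign[of "{1..n}" \<epsilon>] by auto
      show ?thesis using nz[of "- k"] k that by (simp add: gauge_b_def)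
    qed
    have nz_b_bar: "sinh (\<eta> * gauge_b_bar m \<beta> \<epsilon>' \<epsilon> n) \<noteq> 0" for \<epsilon>' \<epsilon> n
    proof -
      obtain k :: int where k: "\<bar>k\<bar> \<le> int m" "(\<Sum>r=1..m. label_sign (\<epsilon> r)) = of_int k"
        using sum_label_sign[of "{1..m}" \<epsilon>] by auto
      obtain h :: int where h: "\<bar>h\<bar> \<le> int m" "(\<Sum>r=n+1..m. label_sign (\<epsilon>' r)) = of_int h"
        using sum_label_sign[of "{n+1..m}" \<epsilon>'] by fastforce
      show ?thesis using nz[of "h - k"] k h by (simp add: gauge_b_bar_def algebra_simps)
    qed
    have defined: "monomials_defined \<eta> \<xi> m \<alpha> \<beta>"
      by (simp add: monomials_defined_def invertible_det_nz det_gauge_S nz_b)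

    \<comment> \<open>The local column and row factors of the monomial. Since \<open>q\<close> is
      free of \<open>\<epsilon>'\<close>, for fixed \<open>\<epsilon>\<close> all monomials share
      one covector.\<close>
    define p where "p \<epsilon> \<epsilon>' n k =
      gauge_S \<eta> (- \<xi> n) (\<alpha> - 1) (gauge_b_bar m \<beta> \<epsilon>' \<epsilon> n) $ k $ \<epsilon>' n" for \<epsilon> \<epsilon>' n k
    define q where "q \<epsilon> n k =
      matrix_inv (gauge_S \<eta> (- \<xi> n) (\<alpha> + 1) (gauge_b \<beta> \<epsilon> n)) $ \<epsilon> n $ k" for \<epsilon> n k
    let ?V = "\<lambda>\<epsilon> \<epsilon>'. product_tensor m (p \<epsilon> \<epsilon>')" and ?W = "\<lambda>\<epsilon>. product_tensor m (q \<epsilon>)"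
    have monomial: "monomial \<eta> \<xi> m \<alpha> \<beta> \<epsilon>' \<epsilon> = rank_one m (?V \<epsilon> \<epsilon>') (?W \<epsilon>)" for \<epsilon> \<epsilon>'
      unfolding monomial_def
      by (rule foldr_site_op_rank_one) (use assms(2) in \<open>auto simp: gauge_E_nth p_def q_def\<close>)

    have V: "tensor_space m \<subseteq> tensor.span (?V \<epsilon> ` tuples m)" for \<epsilon>
    \<comment> \<open>\<open>gauge_b_bar\<close> at \<open>n\<close> sees only the labels
      \<open>\<epsilon>' r\<close> with \<open>r > n\<close>, so the order of the sites is
      reversed.\<close>
    proof (rule tensor_space_subset_span_product_tensor[where r = "\<lambda>n. - int n"])
      fix n k :: nat and \<epsilon>' :: "nat \<Rightarrow> 2" and j :: 2
      have *: "gauge_b_bar m \<beta> (\<epsilon>'(k := j)) \<epsilon> n = gauge_b_bar m \<beta> \<epsilon>' \<epsilon> n" if "k \<le> n"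
        using that by (auto simp: gauge_b_bar_def intro!: sum.cong)
      show "p \<epsilon> (\<epsilon>'(k := j)) n = p \<epsilon> \<epsilon>' n" if "- int n \<le> - int k" "n \<noteq> k"
        using that by (simp add: p_def * fun_eq_iff)
      \<comment> \<open>The sum in \<open>gauge_b_bar\<close> starts after the site, so the two
        vectors at \<open>k\<close> are the two columns of a single gauge matrix.\<close>
      have **: "gauge_b_bar m \<beta> (\<epsilon>'(k := j)) \<epsilon> k = gauge_b_bar m \<beta> \<epsilon>' \<epsilon> k" for j
        by (auto simp: gauge_b_bar_def intro!: sum.cong)
      have "det (gauge_S \<eta> (- \<xi> k) (\<alpha> - 1) (gauge_b_bar m \<beta> \<epsilon>' \<epsilon> k)) \<noteq> 0"
        by (simp add: det_gauge_S nz_b_bar)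
      then show "p \<epsilon> (\<epsilon>'(k := 1)) k 1 * p \<epsilon> (\<epsilon>'(k := 2)) k 2 \<noteq>
          p \<epsilon> (\<epsilon>'(k := 2)) k 1 * p \<epsilon> (\<epsilon>'(k := 1)) k 2"
        by (simp add: p_def ** det_2)
    qed

    have W: "tensor_space m \<subseteq> tensor.span (?W ` tuples m)"
    proof (rule tensor_space_subset_span_product_tensor[where r = int])
      fix n k :: nat and \<epsilon> :: "nat \<Rightarrow> 2" and j :: 2
      have *: "gauge_b \<beta> (\<epsilon>(k := j)) n = gauge_b \<beta> \<epsilon> n" if "n < k"
        using that by (auto simp: gauge_b_def intro!: sum.cong)
      show "q (\<epsilon>(k := j)) n = q \<epsilon> n" if "int n \<le> int k" "n \<noteq> k"
        using that by (simp add: q_def * fun_eq_iff)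
      assume k: "k \<in> {1..m}"
      define b where "b = gauge_b \<beta> \<epsilon> (k - 1)"
      have b: "gauge_b \<beta> (\<epsilon>(k := j)) k = b - label_sign j" for j
      proof -
        have "{1..k} = insert k {1..k - 1}" "k \<notin> {1..k - 1}" using k by auto
        moreover have "(\<Sum>r=1..k-1. label_sign ((\<epsilon>(k := j)) r)) = (\<Sum>r=1..k-1. label_sign (\<epsilon> r))"
          using k by (auto intro!: sum.cong)
        ultimately show ?thesis
          using k by (simp add: gauge_b_def b_def sum.insert del: One_nat_def)
      qed
      \<comment> \<open>Here the label at \<open>k\<close> shifts its own parameter, so the two
        covectors are rows of two different inverses.\<close>
      have b1: "gauge_b \<beta> (\<epsilon>(k := 1)) k = b + 1" and b2: "gauge_b \<beta> (\<epsilon>(k := 2)) k = b - 1"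
        by (simp_all add: b label_sign_def)
      have k1: "k - 1 \<le> m" using k by auto
      have "sinh (\<eta> * b) \<noteq> 0" "sinh (\<eta> * (b + 1)) \<noteq> 0" "sinh (\<eta> * (b - 1)) \<noteq> 0"
        using nz_b[OF k1, of \<epsilon>] nz_b[of k "\<epsilon>(k := 1)"] nz_b[of k "\<epsilon>(k := 2)"] k
        unfolding b1 b2 b_def[symmetric] by auto
      from rows_matrix_inv_gauge_S_independent[OF this]
      show "q (\<epsilon>(k := 1)) k 1 * q (\<epsilon>(k := 2)) k 2 \<noteq> q (\<epsilon>(k := 2)) k 1 * q (\<epsilon>(k := 1)) k 2"
        by (simp add: q_def b1 b2)
    qed

    define B where "B = monomials \<eta> \<xi> m \<alpha> \<beta>"
    have B: "B = (\<lambda>(\<epsilon>, \<epsilon>'). rank_one m (?V \<epsilon> \<epsilon>') (?W \<epsilon>)) ` (tuples m \<times> tuples m)"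
      by (auto simp: B_def monomials_def monomial)
    have base: "rank_one m (?V \<epsilon> \<epsilon>') (?W \<epsilon>) \<in> op.span B"
      if "\<epsilon> \<in> tuples m" "\<epsilon>' \<in> tuples m" for \<epsilon> \<epsilon>'
      by (rule op.span_base) (use that in \<open>auto simp: B\<close>)
    \<comment> \<open>First the vector is freed with the covector \<open>?W \<epsilon>\<close>
      fixed, then the covector; each time the admissible tensors form a subspace that contains a
      spanning set.\<close>
    have rank_one_V: "rank_one m \<psi> (?W \<epsilon>) \<in> op.span B"
      if "\<psi> \<in> tensor_space m" "\<epsilon> \<in> tuples m" for \<psi> \<epsilon>
    proof -
      have "tensor.span (?V \<epsilon> ` tuples m) \<subseteq> {\<psi>. rank_one m \<psi> (?W \<epsilon>) \<in> op.span B}"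
        by (rule tensor.span_minimal)
          (use that(2) base in \<open>auto simp: tensor.subspace_def rank_one_left op.span_zero
            intro!: op.span_add op.span_scale\<close>)
      then show ?thesis using V that by blast
    qed
    have rank_one: "rank_one m \<psi> \<phi> \<in> op.span B"
      if "\<psi> \<in> tensor_space m" "\<phi> \<in> tensor_space m" for \<psi> \<phi>
    proof -
      have "tensor.span (?W ` tuples m) \<subseteq> {\<phi>. rank_one m \<psi> \<phi> \<in> op.span B}"
        by (rule tensor.span_minimal)
          (use that(1) in \<open>auto simp: tensor.subspace_def rank_one_right op.span_zero
            intro!: rank_one_V op.span_add op.span_scale\<close>)
      then show ?thesis using W that by blast
    qed
    have "A \<in> op.span B" if A: "A \<in> End_tensor m" for A
    proof -
      have "A (unit_tensor \<sigma>) \<in> tensor_space m" if "\<sigma> \<in> tuples m" for \<sigma>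
        using A unit_tensor_in_tensor_space[OF that] by (auto simp: End_tensor_def)
      then show ?thesis
        by (subst End_eq_sum_rank_one[OF A])
          (auto intro!: op.span_sum rank_one unit_tensor_in_tensor_space)
    qed
    moreover have "op.span B \<subseteq> End_tensor m"
      by (rule op.span_minimal)
        (auto simp: B subspace_End rank_one_in_End product_tensor_in_tensor_space)
    ultimately have span: "op.span B = End_tensor m" by blast

    have "op.independent B"
    proof (rule op.independent_if_card_le[OF _ independent_rank_one_unit])
      show "finite B" by (simp add: B)
      show "(\<lambda>(\<sigma>, \<tau>). rank_one m (unit_tensor \<sigma>) (unit_tensor \<tau>)) ` (tuples m \<times> tuples m)
          \<subseteq> op.span B"
        by (auto intro!: rank_one unit_tensor_in_tensor_space)
      \<comment> \<open>Coincidences between monomials could only make \<open>B\<close> smaller, so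
        the number of label pairs bounds \<open>card B\<close>.\<close>
      show "card B \<le>
          card ((\<lambda>(\<sigma>, \<tau>). rank_one m (unit_tensor \<sigma>) (unit_tensor \<tau>)) ` (tuples m \<times> tuples m))"
        unfolding B card_image[OF inj_rank_one_unit] by (rule card_image_le) simp
    qed
    with defined span show ?thesis by (simp add: B_def)
  qed
  have "finite F" by (simp add: F_def)
  with main show ?thesis by blast
qed

end
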